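(* There is a constant $C>0$ such that for all positive integers $n,m$, $$\sqrt{4mn-2(m+n)+\tfrac14}+\tfrac12\ \le\ \mathrm{M}_2(n,m)\ \le\ 2\sqrt{2}\sqrt{mn}+C(\sqrt{n}+\sqrt{m}).$$
   Context: A complete sparse ruler of length $n$ and height $m$ in two dimensions (an $(n,m)$-ruler) is a subset $R\subseteq\{0,1,\dots,n-1\}\times\{0,1,\dots,m-1\}$ such that for every $(x,y)\in\mathbb{Z}^2$ with $|x|\le n-1$ and $|y|\le m-1$ there exist $r_1,r_2\in R$ with $r_1-r_2=(x,y)$. $\mathrm{M}_2(n,m)$ denotes the minimum number of elements of an $(n,m)$-ruler. *)

theory Defs
  imports Complex_Main "HOL-Library.Product_Plus"
begin

definition is_ruler :: "nat \<Rightarrow> nat \<Rightarrow> (int \<times> int) set \<Rightarrow> bool" where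
  "is_ruler n m R \<longleftrightarrow>
     R \<subseteq> {0..int n - 1} \<times> {0..int m - 1} \<and>
     (\<forall>x y. \<bar>x\<bar> \<le> int n - 1 \<and> \<bar>y\<bar> \<le> int m - 1 \<longrightarrow>
        (\<exists>r1\<in>R. \<exists>r2\<in>R. r1 - r2 = (x, y)))"

definition M2 :: "nat \<Rightarrow> nat \<Rightarrow> nat" where
  "M2 n m = (LEAST k. \<exists>R. is_ruler n m R \<and> card R = k)"

text \<open>The full grid is a ruler, so the minimum above is taken over a nonempty set.\<close>

lemma is_ruler_full: "is_ruler n m ({0..int n - 1} \<times> {0..int m - 1})"
  unfolding is_ruler_def
proof (intro conjI allI impI)
  fix x y :: int
  assume "\<bar>x\<bar> \<le> int n - 1 \<and> \<bar>y\<bar> \<le> int m - 1"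
  then show "\<exists>r1\<in>{0..int n - 1} \<times> {0..int m - 1}.
      \<exists>r2\<in>{0..int n - 1} \<times> {0..int m - 1}. r1 - r2 = (x, y)"
    by (intro bexI[of _ "(max x 0, max y 0)"] bexI[of _ "(max (-x) 0, max (-y) 0)"]) auto
qed simp

end

theory Submission
  imports Defs
begin

text \<open>
  Lower bound: a ruler with \<open>k\<close> points has at most \<open>k\<^sup>2 - k\<close> nonzero differences, and all
  \<open>(2n-1)(2m-1) - 1\<close> nonzero vectors must occur.

  Upper bound: up to sign it suffices to represent \<open>(x, y)\<close> with \<open>x \<ge> 0\<close>, so we need \<open>A, B\<close> in the
  grid with \<open>A - B\<close> covering \<open>[0, n-1] \<times> [-(m-1), m-1]\<close>, about \<open>2mn\<close> vectors, which
  \<open>\<bar>A\<bar> \<approx> \<bar>B\<bar> \<approx> \<surd>(2mn)\<close> achieves if few are represented twice. Both sets are products. Let \<open>A\<close> be a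
  sparse grid with steps \<open>a \<approx> \<surd>n\<close> and \<open>b \<approx> \<surd>(m/2)\<close>, and let \<open>B\<close> consist of two full \<open>a \<times> b\<close> blocks,
  one in each corner of the side \<open>x = 0\<close>: one block yields the differences with \<open>y \<ge> 0\<close>, the other
  those with \<open>y \<le> 0\<close>.
\<close>

lemma is_ruler_finite: "is_ruler n m R \<Longrightarrow> finite R"
  unfolding is_ruler_def by (meson finite_SigmaI finite_atLeastAtMost_int finite_subset)

lemma is_ruler_card_lower:
  assumes R: "is_ruler n m R" and "n > 0" "m > 0"
  shows "(2 * int n - 1) * (2 * int m - 1) - 1 \<le> int (card R) ^ 2 - int (card R)"
proof -
  have fin: "finite R" using R by (rule is_ruler_finite)
  \<comment> \<open>The \<open>card R\<close> pairs on the diagonal all have difference zero, so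
    only the pairs off it can produce the nonzero vectors of \<open>?D\<close>.\<close>
  let ?P = "R \<times> R - Id_on R"
  let ?D = "{-(int n - 1)..int n - 1} \<times> {-(int m - 1)..int m - 1} - {(0, 0)}"
  have sub: "?D \<subseteq> (\<lambda>(r, s). r - s) ` ?P"
  proof
    fix d assume d: "d \<in> ?D"
    obtain x y where xy: "d = (x, y)" by fastforce
    have "\<bar>x\<bar> \<le> int n - 1" "\<bar>y\<bar> \<le> int m - 1" using d xy by auto
    then obtain r s where rs: "r \<in> R" "s \<in> R" "r - s = (x, y)"
      using R unfolding is_ruler_def by meson
    have "r \<noteq> s" using rs d xy by (auto simp: zero_prod_def)
    with rs xy show "d \<in> (\<lambda>(r, s). r - s) ` ?P"
      by (intro image_eqI[of _ _ "(r, s)"]) auto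
  qed
  have card_diag: "card (Id_on R) = card R"
    by (simp add: Id_on_def UNION_singleton_eq_range card_image inj_on_def)
  have "int (card ?D) = (2 * int n - 1) * (2 * int m - 1) - 1"
  proof -
    have "?D \<union> {(0, 0)} = {-(int n - 1)..int n - 1} \<times> {-(int m - 1)..int m - 1}"
      using assms(2,3) by auto
    then have "card ?D + 1 = card ({-(int n - 1)..int n - 1} \<times> {-(int m - 1)..int m - 1})"
      by (metis (no_types, lifting) DiffE Un_insert_right add.commute card_insert_disjoint
          finite_Diff finite_SigmaI finite_atLeastAtMost_int insertI1 plus_1_eq_Suc sup_bot_right)
    also have "int \<dots> = (2 * int n - 1) * (2 * int m - 1)"
      using assms(2,3) by (simp add: card_cartesian_product)
    finally show ?thesis by simp
  qed
  moreover have "int (card ?P) = int (card R) ^ 2 - int (card R)"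
  proof -
    have "card (Id_on R) \<le> card (R \<times> R)"
      by (rule card_mono) (use fin in auto)
    moreover have "card ?P = card (R \<times> R) - card (Id_on R)"
      by (rule card_Diff_subset) (use fin in \<open>auto intro: finite_subset[of _ "R \<times> R"]\<close>)
    ultimately show ?thesis
      using card_diag by (simp add: of_nat_diff card_cartesian_product power2_eq_square)
  qed
  moreover have "card ?D \<le> card ?P"
    using surj_card_le[OF _ sub] fin by auto
  ultimately show ?thesis by linarith
qed

text \<open>The teeth are counted down from the top \<open>N - 1\<close>, not up from 0: the
  difference \<open>N - 1\<close> forces the top to be a tooth, and any irregular gap then lies at
  the bottom.\<close>

definition comb :: "int \<Rightarrow> int \<Rightarrow> int set" where
  "comb N a = (\<lambda>i. N - 1 - a * i) ` {0..(N - 1) div a}"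

lemma comb_subset:
  assumes "a > 0"
  shows "comb N a \<subseteq> {0..N - 1}"
proof -
  have "0 \<le> N - 1 - a * i" if "i \<le> (N - 1) div a" for i
  proof -
    have "a * i \<le> a * ((N - 1) div a)"
      using that assms by (intro mult_left_mono) auto
    also have "\<dots> \<le> N - 1"
      using mult_div_mod_eq[of a "N - 1"] pos_mod_sign[OF assms, of "N - 1"] by linarith
    finally show ?thesis by simp
  qed
  moreover have "N - 1 - a * i \<le> N - 1" if "0 \<le> i" for i
    using mult_nonneg_nonneg[of a i] that assms by linarith
  ultimately show ?thesis unfolding comb_def by fastforce
qed

lemma card_comb_le:
  assumes "N > 0" "a > 0"
  shows "real (card (comb N a)) \<le> N / a + 1"
proof -
  have nonneg: "(N - 1) div a \<ge> 0"
    using assms by (simp add: pos_imp_zdiv_nonneg_iff)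
  have "real (card (comb N a)) \<le> real (card {0..(N - 1) div a})"
    unfolding comb_def of_nat_le_iff by (rule card_image_le) simp
  also have "\<dots> = of_int ((N - 1) div a) + 1"
    using nonneg by simp
  also have "of_int ((N - 1) div a) \<le> (of_int (N - 1) / of_int a :: real)"
    by (rule real_of_int_div4)
  also have "\<dots> \<le> N / a"
    using assms by (intro divide_right_mono) auto
  finally show ?thesis by simp
qed

text \<open>Divide the distance \<open>N - 1 - x\<close> by \<open>a\<close>: the quotient selects
  the tooth and the remainder is \<open>v\<close>.\<close>

lemma comb_covers:
  assumes "a > 0" "x \<in> {0..N - 1}"
  shows "\<exists>u\<in>comb N a. \<exists>v\<in>{0..a - 1}. u - v = x"
proof (intro bexI)
  let ?z = "N - 1 - x"
  show "(N - 1 - a * (?z div a)) - ?z mod a = x"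
    using mult_div_mod_eq[of a ?z] by linarith
  show "?z mod a \<in> {0..a - 1}"
    using assms by auto
  have "?z div a \<le> (N - 1) div a" "0 \<le> ?z div a"
    using assms by (auto intro: zdiv_mono1 simp: pos_imp_zdiv_nonneg_iff)
  then show "N - 1 - a * (?z div a) \<in> comb N a"
    by (auto simp: comb_def)
qed

text \<open>The extra tooth at \<open>0\<close> is needed because the last step of the comb may stop short of it.\<close>

lemma comb_covers_neg:
  assumes "a > 0" "x \<in> {0..N - 1}"
  shows "\<exists>u\<in>insert 0 (comb N a). \<exists>v\<in>{N - a..N - 1}. u - v = - x"
proof -
  \<comment> \<open>With tooth number \<open>q\<close> and block offset \<open>r\<close>, the
    equation \<open>(N - 1 - a * q) - (N - a + r) = - x\<close> reads
    \<open>a * q + r = x + a - 1\<close>, again a division with remainder.\<close>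
  let ?q = "(x + a - 1) div a" and ?r = "(x + a - 1) mod a"
  have eq: "a * ?q + ?r = x + a - 1" by simp
  have r: "0 \<le> ?r" "?r < a" using assms by auto
  have q: "0 \<le> ?q" using assms by (simp add: pos_imp_zdiv_nonneg_iff)
  show ?thesis
  proof (cases "?q \<le> (N - 1) div a")
    case True
    show ?thesis
    proof (intro bexI)
      show "(N - 1 - a * ?q) - (N - a + ?r) = - x"
        using eq by linarith
      show "N - a + ?r \<in> {N - a..N - 1}" using r by auto
      show "N - 1 - a * ?q \<in> insert 0 (comb N a)"
        using True q by (auto simp: comb_def)
    qed
  next
    \<comment> \<open>The required tooth would be negative. This happens only when \<open>x\<close>
      itself lies in the top block, and then \<open>0 - x\<close> does the job.\<close>
    case False
    then have "a * ((N - 1) div a) + a \<le> a * ?q"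
      using mult_left_mono[of "(N - 1) div a + 1" ?q a] assms by (simp add: distrib_left)
    moreover have "a * ((N - 1) div a) + (N - 1) mod a = N - 1" by simp
    moreover have "(N - 1) mod a < a" using assms by simp
    ultimately have "N - 1 < a * ?q" by linarith
    then have "x \<in> {N - a..N - 1}"
      using eq r(1) assms(2) unfolding atLeastAtMost_iff by linarith
    then show ?thesis
      by (intro bexI[of _ 0] bexI[of _ x]) auto
  qed
qed

text \<open>Swapping the two points negates a difference, so half of the vectors suffice.\<close>

lemma is_rulerI_half:
  assumes sub: "R \<subseteq> {0..int n - 1} \<times> {0..int m - 1}"
    and cov: "\<And>x y. 0 \<le> x \<Longrightarrow> x \<le> int n - 1 \<Longrightarrow> \<bar>y\<bar> \<le> int m - 1 \<Longrightarrow> \<exists>r\<in>R. \<exists>s\<in>R. r - s = (x, y)"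
  shows "is_ruler n m R"
  unfolding is_ruler_def
proof (intro conjI allI impI)
  fix x y :: int
  assume xy: "\<bar>x\<bar> \<le> int n - 1 \<and> \<bar>y\<bar> \<le> int m - 1"
  show "\<exists>r\<in>R. \<exists>s\<in>R. r - s = (x, y)"
  proof (cases "0 \<le> x")
    case True
    then show ?thesis using cov xy by auto
  next
    case False
    then obtain r s where "r \<in> R" "s \<in> R" "r - s = (- x, - y)"
      using cov[of "- x" "- y"] xy by auto
    moreover from this(3) have "s - r = (x, y)"
      by (auto simp: prod_eq_iff)
    ultimately show ?thesis by blast
  qed
qed (rule sub)

text \<open>Both sets are products, so the coordinates are solved independently. In
  \<open>m / b + 2\<close> one unit is the first tooth and the other the extra tooth 0; the last
  term counts the two blocks.\<close>

lemma ruler_from_combs: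
  fixes a b :: int
  assumes a: "0 < a" "a \<le> int n" and b: "0 < b" "b \<le> int m"
  shows "\<exists>R. is_ruler n m R \<and>
    real (card R) \<le> (n / a + 1) * (m / b + 2) + 2 * real_of_int a * real_of_int b"
proof -
  let ?N = "int n" and ?M = "int m"
  define A2 where "A2 = insert 0 (comb ?M b)"
  define B2 where "B2 = {0..b - 1} \<union> {?M - b..?M - 1}"
  define R where "R = comb ?N a \<times> A2 \<union> {0..a - 1} \<times> B2"
  have sub: "R \<subseteq> {0..?N - 1} \<times> {0..?M - 1}"
    using comb_subset[OF a(1), of ?N] comb_subset[OF b(1), of ?M] a b
    unfolding R_def A2_def B2_def by auto
  have "is_ruler n m R"
  proof (rule is_rulerI_half[OF sub])
    fix x y assume xy: "0 \<le> x" "x \<le> ?N - 1" "\<bar>y\<bar> \<le> ?M - 1"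
    obtain u v where uv: "u \<in> comb ?N a" "v \<in> {0..a - 1}" "u - v = x"
      using comb_covers[OF a(1), of x ?N] xy by auto
    have "\<exists>u'\<in>A2. \<exists>v'\<in>B2. u' - v' = y"
    proof (cases "0 \<le> y")
      case True
      then show ?thesis
        using comb_covers[OF b(1), of y ?M] xy unfolding A2_def B2_def by fastforce
    next
      case False
      then show ?thesis
        using comb_covers_neg[OF b(1), of "- y" ?M] xy unfolding A2_def B2_def by fastforce
    qed
    then obtain u' v' where "u' \<in> A2" "v' \<in> B2" "u' - v' = y" by blast
    with uv show "\<exists>r\<in>R. \<exists>s\<in>R. r - s = (x, y)"
      unfolding R_def by (intro bexI[of _ "(u, u')"] bexI[of _ "(v, v')"]) auto
  qed
  moreover have "real (card R) \<le> (n / a + 1) * (m / b + 2) + 2 * real_of_int a * real_of_int b"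
  proof -
    have "card A2 \<le> card (comb ?M b) + 1"
      unfolding A2_def by (simp add: card_insert_le_m1)
    then have A2: "real (card A2) \<le> m / b + 2"
      using card_comb_le[of ?M b] b by simp
    have A1: "real (card (comb ?N a)) \<le> n / a + 1"
      using card_comb_le[of ?N a] a by simp
    have "card B2 \<le> nat b + nat b"
      unfolding B2_def by (rule order_trans[OF card_Un_le]) simp
    then have B2: "real (card B2) \<le> 2 * b"
      using b by linarith
    have "card R \<le> card (comb ?N a) * card A2 + card {0..a - 1} * card B2"
      unfolding R_def by (rule order_trans[OF card_Un_le]) (simp add: card_cartesian_product)
    then have "real (card R) \<le> real (card (comb ?N a)) * card A2 + real (card {0..a - 1}) * card B2"
      by (metis of_nat_add of_nat_le_iff of_nat_mult)
    also have "\<dots> \<le> (n / a + 1) * (m / b + 2) + real_of_int a * (2 * real_of_int b)"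
      using A1 A2 B2 a b by (intro add_mono mult_mono) auto
    finally show ?thesis by simp
  qed
  ultimately show ?thesis by blast
qed

lemma sqrt_le_self: "1 \<le> x \<Longrightarrow> sqrt x \<le> x"
  by (rule real_le_lsqrt) (auto simp: power2_eq_square)

text \<open>The main terms \<open>m * n / (a * b)\<close> and \<open>2 * a * b\<close> balance at
  \<open>a * b = sqrt (m * n / 2)\<close>, each being \<open>sqrt (2 * m * n)\<close>. Splitting
  this product as \<open>sqrt n\<close> times \<open>sqrt (m / 2)\<close> keeps the remaining terms
  of order \<open>sqrt n + sqrt m\<close>.\<close>

lemma ruler_exists_upper:
  assumes "n > 0" "m > 0"
  shows "\<exists>R. is_ruler n m R \<and>
    real (card R) \<le> 2 * sqrt 2 * sqrt (real m * real n) + 6 * (sqrt n + sqrt m)"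
proof -
  define a where "a = \<lceil>sqrt n\<rceil>"
  define b where "b = \<lceil>sqrt (m / 2)\<rceil>"
  let ?s = "sqrt n" and ?t = "sqrt m" and ?w = "sqrt 2"
  have s: "1 \<le> ?s" and t: "1 \<le> ?t" using assms by auto
  have w: "0 < ?w" "?w * ?w = 2" "?w \<le> 2" by (auto intro: real_le_lsqrt)
  have half: "sqrt (m / 2) = ?t / ?w" by (rule real_sqrt_divide)
  have a_bounds: "?s \<le> a" "a \<le> ?s + 1" unfolding a_def by linarith+
  have b_bounds: "?t / ?w \<le> b" "b \<le> ?t / ?w + 1" unfolding b_def half by linarith+
  have "?s \<le> n" using assms by (intro sqrt_le_self) auto
  then have a: "0 < a" "a \<le> int n"
    using s unfolding a_def by (auto simp: ceiling_le_iff)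
  have "sqrt (m / 2) \<le> ?t" by simp
  also have "?t \<le> m" using assms by (intro sqrt_le_self) auto
  finally have b: "0 < b" "b \<le> int m"
    using assms unfolding b_def by (auto simp: ceiling_le_iff)
  obtain R where R: "is_ruler n m R" "real (card R) \<le> (n / a + 1) * (m / b + 2) + 2 * real_of_int a * real_of_int b"
    using ruler_from_combs[OF a b] by blast
  have na: "n / a \<le> ?s"
  proof -
    have "real n = ?s * ?s" by simp
    also have "\<dots> \<le> ?s * a" using a_bounds s by (intro mult_left_mono) auto
    finally show ?thesis using a by (simp add: divide_le_eq)
  qed
  have mb: "m / b \<le> ?w * ?t"
  proof -
    have "real m = ?w * ?t * (?t / ?w)" using w by simp
    also have "\<dots> \<le> ?w * ?t * b" using b_bounds w t by (intro mult_left_mono) auto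
    finally show ?thesis using b by (simp add: divide_le_eq)
  qed
  have "(n / a + 1) * (m / b + 2) \<le> (?s + 1) * (?w * ?t + 2)"
    using na mb s t w a b by (intro mult_mono add_mono) auto
  moreover have "2 * real_of_int a * real_of_int b \<le> 2 * (?s + 1) * (?t / ?w + 1)"
    using a_bounds b_bounds s t w a b by (intro mult_mono) auto
  moreover have "?t / ?w = ?w * ?t / 2" using w by (simp add: field_simps)
  ultimately have "real (card R) \<le> (?s + 1) * (?w * ?t + 2) + 2 * (?s + 1) * (?w * ?t / 2 + 1)"
    using R(2) by simp
  also have "\<dots> = 2 * ?w * (?t * ?s) + 4 * ?s + 2 * (?w * ?t) + 4"
    by (simp add: algebra_simps)
  \<comment> \<open>The constant 6 arises as 4 + 2: \<open>?w \<le> 2\<close> gives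
    \<open>4 * (?s + ?t) + 4\<close>, and the last 4 is at most
    \<open>2 * (?s + ?t)\<close>.\<close>
  also have "\<dots> \<le> 2 * ?w * (?t * ?s) + 6 * (?s + ?t)"
  proof -
    have "?w * ?t \<le> 2 * ?t" using w(3) t by (intro mult_right_mono) auto
    then have "4 * ?s + 2 * (?w * ?t) + 4 \<le> 6 * (?s + ?t)" using s t by argo
    then show ?thesis by argo
  qed
  finally show ?thesis using R(1) by (auto simp: real_sqrt_mult)
qed

lemma M2_attained: "\<exists>R. is_ruler n m R \<and> card R = M2 n m"
  unfolding M2_def by (rule LeastI_ex) (use is_ruler_full in blast)

lemma M2_le: "is_ruler n m R \<Longrightarrow> M2 n m \<le> card R"
  unfolding M2_def by (rule Least_le) blast

lemma M2_lower:
  assumes "n > 0" "m > 0"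
  shows "sqrt (4 * real m * real n - 2 * (real m + real n) + 1 / 4) + 1 / 2 \<le> real (M2 n m)"
proof -
  obtain R where R: "is_ruler n m R" "card R = M2 n m"
    using M2_attained by blast
  let ?k = "real (M2 n m)"
  \<comment> \<open>Nonemptiness makes \<open>?k - 1 / 2\<close> nonnegative, as needed to take the
    root of the completed square \<open>(?k - 1 / 2) ^ 2\<close> below.\<close>
  have "\<exists>r\<in>R. \<exists>s\<in>R. r - s = (0, 0)"
    using R(1) assms unfolding is_ruler_def by simp
  then have "R \<noteq> {}" by blast
  then have k: "1 \<le> ?k"
    using R is_ruler_finite card_gt_0_iff by (metis One_nat_def Suc_leI of_nat_1 of_nat_le_iff)
  have "real_of_int ((2 * int n - 1) * (2 * int m - 1) - 1) \<le> real_of_int (int (M2 n m) ^ 2 - int (M2 n m))"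
    using is_ruler_card_lower[OF R(1) assms] R(2) by (simp only: of_int_le_iff)
  then have "4 * real m * real n - 2 * (real m + real n) + 1 / 4 \<le> (?k - 1 / 2) ^ 2"
    by (simp add: algebra_simps power2_eq_square)
  then have "sqrt (4 * real m * real n - 2 * (real m + real n) + 1 / 4) \<le> ?k - 1 / 2"
    using k by (intro real_le_lsqrt) auto
  then show ?thesis by simp
qed

theorem theorem10:
  "\<exists>C::real. C > 0 \<and> (\<forall>n m::nat. n > 0 \<longrightarrow> m > 0 \<longrightarrow>
     sqrt (4 * real m * real n - 2 * (real m + real n) + 1 / 4) + 1 / 2 \<le> real (M2 n m) \<and>
     real (M2 n m) \<le> 2 * sqrt 2 * sqrt (real m * real n) + C * (sqrt (real n) + sqrt (real m)))"
proof (intro exI[of _ 6] conjI allI impI)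
  fix n m :: nat
  assume nm: "n > 0" "m > 0"
  show "sqrt (4 * real m * real n - 2 * (real m + real n) + 1 / 4) + 1 / 2 \<le> real (M2 n m)"
    using nm by (rule M2_lower)
  show "real (M2 n m) \<le> 2 * sqrt 2 * sqrt (real m * real n) + 6 * (sqrt (real n) + sqrt (real m))"
    using ruler_exists_upper[OF nm] M2_le by (meson of_nat_mono order_trans)
qed simp

end
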